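(* Let $X=(X_1,X_2)$ be bivariate log-normal, $X_i=\exp(Z_i)$ with $Z\sim\mathcal{N}_2(\mu,A)$, where $\mu\in\mathbb{R}^2$ and $A$ is symmetric positive definite with inverse $B=A^{-1}$. Put $b_i=B_{1i}+B_{2i}$ for $i=1,2$, and assume $b_1>b_2$; if $b_2>0$, assume in addition that $\frac{b_1^2}{B_{11}}>\frac{b_2^2}{B_{22}}$. For $\alpha\in(0,1)$ let $q_\alpha(u_1,u_2)$ denote the $\alpha$-quantile of $u_1X_1+u_2X_2$. Then for every $t_1\in(0,1)$, $$q_\alpha(t_1,1-t_1)\sim k_\alpha\cdot(1-t_1)\quad\text{as }\alpha\to1,\qquad k_\alpha=q_\alpha(0,1).$$
   Context: $q_\alpha(u)=\inf\{y\in\mathbb{R}:P(u_1X_1+u_2X_2\le y)\ge\alpha\}$. The notation $f(\alpha)\sim g(\alpha)$ as $\alpha\to1$ means $f(\alpha)/g(\alpha)\to1$. *)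

theory Defs
  imports "HOL-Probability.Probability"
begin

definition pos_def_matrix :: "real ^ 'n ^ 'n \<Rightarrow> bool" where
  "pos_def_matrix A \<longleftrightarrow> transpose A = A \<and> (\<forall>x. x \<noteq> 0 \<longrightarrow> x \<bullet> (A *v x) > 0)"

text \<open>Only meaningful for positive definite \<open>\<Sigma>\<close>, where the normal law has a Lebesgue density.\<close>
definition mv_normal_density :: "real ^ 'n \<Rightarrow> real ^ 'n ^ 'n \<Rightarrow> real ^ 'n \<Rightarrow> real" where
  "mv_normal_density \<mu> \<Sigma> z =
     exp (- ((z - \<mu>) \<bullet> (matrix_inv \<Sigma> *v (z - \<mu>))) / 2) / sqrt ((2 * pi) ^ CARD('n) * det \<Sigma>)"

definition quantile :: "'a measure \<Rightarrow> ('a \<Rightarrow> real) \<Rightarrow> real \<Rightarrow> real" where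
  "quantile M Y \<alpha> = Inf {y. measure M {\<omega> \<in> space M. Y \<omega> \<le> y} \<ge> \<alpha>}"

definition portfolio_quantile :: "'a measure \<Rightarrow> ('a \<Rightarrow> real ^ 2) \<Rightarrow> real \<Rightarrow> real \<Rightarrow> real \<Rightarrow> real" where
  "portfolio_quantile M X \<alpha> u1 u2 = quantile M (\<lambda>\<omega>. u1 * X \<omega> $ 1 + u2 * X \<omega> $ 2) \<alpha>"

end

theory Submission
  imports Defs
begin

text \<open>
  With \<open>B = A\<inverse>\<close>, \<open>b\<^sub>1 - b\<^sub>2 = (A\<^sub>2\<^sub>2 - A\<^sub>1\<^sub>1) / det A\<close>, so \<open>b\<^sub>1 > b\<^sub>2\<close> says that \<open>Z\<^sub>2\<close> has the larger
  variance and \<open>X\<^sub>2\<close> the heavier tail, whatever the correlation. A shift by \<open>h > 0\<close> multiplies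
  the Gaussian tail at \<open>x\<close> by at most \<open>exp (- x h)\<close>; hence, for all \<open>c > 1\<close> and \<open>C > 0\<close>,
  \<open>P (X\<^sub>2 > c k) + P (X\<^sub>1 > C k) \<le> P (X\<^sub>2 > k)\<close> once \<open>k\<close> is large. By a union bound and \<open>X\<^sub>1 \<ge> 0\<close>, the quantile of
  \<open>t\<^sub>1 X\<^sub>1 + t\<^sub>2 X\<^sub>2\<close> then lies between \<open>t\<^sub>2 k\<^sub>\<alpha>\<close> and \<open>c t\<^sub>2 k\<^sub>\<alpha>\<close> for \<open>\<alpha>\<close> close to \<open>1\<close>.
\<close>

section \<open>Linear algebra of 2 by 2 matrices\<close>

lemma matrix_inv_eqI:
  fixes A C :: "'a::semiring_1 ^ 'n ^ 'n"
  assumes "A ** C = mat 1" "C ** A = mat 1"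
  shows "matrix_inv A = C"
proof -
  have "A ** matrix_inv A = mat 1 \<and> matrix_inv A ** A = mat 1"
    unfolding matrix_inv_def by (rule someI[of _ C]) (use assms in auto)
  then show ?thesis
    by (metis assms(1) matrix_mul_assoc matrix_mul_lid matrix_mul_rid)
qed

text \<open>This is the adjugate divided by the determinant; the inner conditionals select the
  opposite diagonal entry.\<close>

lemma matrix_inv_2:
  fixes A :: "'a::field ^ 2 ^ 2"
  assumes "det A \<noteq> 0"
  shows "matrix_inv A = (\<chi> i j. (if i = j then A $ (if i = 1 then 2 else 1) $ (if i = 1 then 2 else 1)
    else - A $ i $ j) / det A)"
proof -
  have "A $ 1 $ 1 * A $ 2 $ 2 / det A - A $ 1 $ 2 * A $ 2 $ 1 / det A = 1"
    using assms by (simp add: diff_divide_distrib[symmetric] det_2[symmetric])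
  then show ?thesis
    by (intro matrix_inv_eqI)
       (auto simp: vec_eq_iff forall_2 matrix_matrix_mult_def sum_2 mat_def algebra_simps)
qed

lemma pos_def_matrix_2:
  fixes A :: "real ^ 2 ^ 2"
  assumes "pos_def_matrix A"
  shows "A $ 2 $ 1 = A $ 1 $ 2" "A $ i $ i > 0" "det A > 0"
proof -
  have "transpose A $ 1 $ 2 = A $ 1 $ 2"
    using assms by (simp add: pos_def_matrix_def)
  then show sym: "A $ 2 $ 1 = A $ 1 $ 2"
    by (simp add: transpose_def)
  have pos: "x \<bullet> (A *v x) > 0" if "x \<noteq> 0" for x
    using assms that by (auto simp: pos_def_matrix_def)
  have diag: "A $ i $ i > 0" for i
    using pos[of "axis i 1"] by (simp add: inner_axis' matrix_vector_mult_basis column_def)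
  then show "A $ i $ i > 0" .
  \<comment> \<open>This vector is chosen so that \<open>A *v ?x\<close> is
    \<open>(0, det A)\<close>; the quadratic form there equals
    \<open>A $ 1 $ 1 * det A\<close>.\<close>
  let ?x = "vector [- A $ 1 $ 2, A $ 1 $ 1] :: real ^ 2"
  have "?x \<noteq> 0"
    using diag[of 1] by (auto simp: vec_eq_iff forall_2)
  from pos[OF this] have "A $ 1 $ 1 * det A > 0"
    by (simp add: inner_vec_def matrix_vector_mult_def sum_2 det_2 sym algebra_simps)
  with diag[of 1] show "det A > 0"
    by (simp add: zero_less_mult_iff)
qed

section \<open>Marginals of the bivariate normal law\<close>

lemma measurable_vec_2:
  fixes i :: 2
  shows "(\<lambda>(x, y). (\<chi> k. if k = i then x else y) :: real ^ 2) \<in> borel_measurable (lborel \<Otimes>\<^sub>M lborel)"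
proof -
  have "continuous_on UNIV (\<lambda>p :: real \<times> real. if k = i then fst p else snd p)" for k
    by (cases "k = i") (auto intro: continuous_intros)
  then have "(\<lambda>(x, y). (\<chi> k. if k = i then x else y) :: real ^ 2) \<in> borel_measurable borel"
    unfolding case_prod_unfold by (intro borel_measurable_continuous_onI continuous_on_vec_lambda)
  then show ?thesis
    by (simp add: lborel_prod)
qed

text \<open>Lebesgue measure is determined by its values on boxes, and a box pulls back to a product
  of two intervals. The index \<open>i\<close> is arbitrary so that either coordinate can be the
  outer variable of an iterated integral.\<close>

lemma lborel_vec_2:
  fixes i :: 2
  shows "(lborel :: (real ^ 2) measure)
    = distr (lborel \<Otimes>\<^sub>M lborel) borel (\<lambda>(x, y). \<chi> k. if k = i then x else y)"
    (is "_ = distr _ _ ?f")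
proof (rule lborel_eqI)
  fix l u :: "real ^ 2"
  \<comment> \<open>Arithmetic in the type \<open>2\<close> is modulo 2, so \<open>i + 1\<close> is
    the other index.\<close>
  define j :: 2 where "j = i + 1"
  have ij: "i \<noteq> j"
    using exhaust_2[of i] unfolding j_def by auto
  have all: "(\<forall>k. P k) \<longleftrightarrow> P i \<and> P j" for P
    using exhaust_2[of i] exhaust_2[of j] ij by (auto simp: forall_2)
  have UNIV: "(UNIV :: 2 set) = {i, j}"
    using all[of "\<lambda>k. k \<in> {i, j}"] by auto
  assume le: "\<And>b. b \<in> Basis \<Longrightarrow> l \<bullet> b \<le> u \<bullet> b"
  have le: "l $ k \<le> u $ k" for k
    using le[of "axis k 1"] by (simp add: inner_axis)
  have meas: "?f \<in> borel_measurable (lborel \<Otimes>\<^sub>M lborel)"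
    by (rule measurable_vec_2)
  have vimage: "?f -` box l u \<inter> space (lborel \<Otimes>\<^sub>M lborel) = {l $ i<..<u $ i} \<times> {l $ j<..<u $ j}"
    using ij by (auto simp: mem_box_cart all space_pair_measure)
  have "(\<Prod>b\<in>Basis. (u - l) \<bullet> b) = (\<Prod>k\<in>UNIV. (u - l) $ k)"
    by (simp add: Basis_vec_def cart_eq_inner_axis axis_eq_axis prod.UNION_disjoint)
  also have "\<dots> = (u $ i - l $ i) * (u $ j - l $ j)"
    using ij by (simp add: UNIV)
  finally show "emeasure (distr (lborel \<Otimes>\<^sub>M lborel) borel ?f) (box l u) = (\<Prod>b\<in>Basis. (u - l) \<bullet> b)"
    using le[of i] le[of j]
    by (simp add: emeasure_distr[OF meas] vimage lborel.emeasure_pair_measure_Times ennreal_mult)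
qed simp

text \<open>Completing the square in \<open>y\<close> splits the density into the marginal of
  coordinate \<open>i\<close> and the conditional density of coordinate \<open>j\<close>, whose mean
  is the regression line and whose variance is the Schur complement
  \<open>det A / A $ i $ i\<close>.\<close>

lemma mv_normal_density_2:
  fixes A :: "real ^ 2 ^ 2" and i j :: 2
  assumes A: "pos_def_matrix A" and ij: "i \<noteq> j"
  shows "mv_normal_density \<mu> A (\<chi> k. if k = i then x else y)
    = normal_density (\<mu> $ i) (sqrt (A $ i $ i)) x
      * normal_density (\<mu> $ j + A $ i $ j * (x - \<mu> $ i) / A $ i $ i) (sqrt (det A / A $ i $ i)) y"
proof -
  note pos = pos_def_matrix_2[OF A]
  define D a d c u v where defs: "D = det A" "a = A $ i $ i" "d = A $ j $ j" "c = A $ i $ j"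
    "u = x - \<mu> $ i" "v = y - \<mu> $ j"
  have D: "D = a * d - c\<^sup>2" and D0: "D > 0" and a0: "a > 0"
    using exhaust_2[of i] exhaust_2[of j] ij pos
    by (auto simp: defs det_2 power2_eq_square algebra_simps)
  let ?z = "(\<chi> k. if k = i then x else y) - \<mu>"
  have "?z \<bullet> (matrix_inv A *v ?z) = (d * u\<^sup>2 - 2 * c * u * v + a * v\<^sup>2) / D"
    using exhaust_2[of i] exhaust_2[of j] ij pos(1) pos(3)
    by (auto simp: defs matrix_inv_2 matrix_vector_mult_def inner_vec_def sum_2 divide_simps
        power2_eq_square algebra_simps)
  also have "\<dots> = u\<^sup>2 / a + (v - c * u / a)\<^sup>2 / (D / a)"
  proof -
    have d: "d = (D + c\<^sup>2) / a" using D a0 by (simp add: field_simps)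
    show ?thesis
      unfolding d using a0 D0 by (simp add: field_simps power2_eq_square)
  qed
  finally have exponent: "?z \<bullet> (matrix_inv A *v ?z) = \<dots>" .
  have root: "sqrt ((2 * pi) ^ CARD(2) * D) = sqrt (2 * pi * a) * sqrt (2 * pi * (D / a))"
    using a0 by (simp add: real_sqrt_mult[symmetric] power2_eq_square)
  have "y - (\<mu> $ j + c * u / a) = v - c * u / a"
    by (simp add: defs)
  then show ?thesis
    using a0 D0 unfolding mv_normal_density_def normal_density_def defs(1)[symmetric]
      defs(2)[symmetric] defs(4)[symmetric] defs(5)[symmetric] exponent root
    by (simp add: exp_add[symmetric] field_simps)
qed

text \<open>By Tonelli the conditional factor is integrated out first. Its mean depends on
  \<open>x\<close>, but its total mass is 1 for every mean.\<close>

lemma mv_normal_marginal: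
  fixes A :: "real ^ 2 ^ 2"
  assumes A: "pos_def_matrix A"
    and Z: "distributed M lborel Z (\<lambda>z. ennreal (mv_normal_density \<mu> A z))"
  shows "distributed M lborel (\<lambda>\<omega>. Z \<omega> $ i) (normal_density (\<mu> $ i) (sqrt (A $ i $ i)))"
proof -
  define j :: 2 where "j = i + 1"
  have ij: "i \<noteq> j"
    using exhaust_2[of i] unfolding j_def by auto
  have Zm[measurable]: "Z \<in> borel_measurable M"
    using distributed_measurable[OF Z] by simp
  have [measurable]: "(\<lambda>\<omega>. Z \<omega> $ i) \<in> borel_measurable M"
    by (rule measurable_compose[OF Zm borel_measurable_nth])
  have dens[measurable]: "(\<lambda>z. ennreal (mv_normal_density \<mu> A z)) \<in> borel_measurable borel"
    using distributed_borel_measurable[OF Z] by simp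
  let ?f = "\<lambda>(x, y). \<chi> k::2. if k = i then x else (y :: real)"
  have meas[measurable]: "?f \<in> borel_measurable (lborel \<Otimes>\<^sub>M lborel)"
    by (rule measurable_vec_2)
  let ?N = "normal_density (\<mu> $ i) (sqrt (A $ i $ i))"
  let ?m = "\<lambda>x. \<mu> $ j + A $ i $ j * (x - \<mu> $ i) / A $ i $ i" and ?s = "sqrt (det A / A $ i $ i)"
  have one: "(\<integral>\<^sup>+ y. ennreal (normal_density m ?s y) \<partial>lborel) = 1" for m
    using prob_space.emeasure_space_1[OF prob_space_normal_density[of ?s m]] pos_def_matrix_2[OF A]
    by (simp add: emeasure_density)
  have "distr M lborel (\<lambda>\<omega>. Z \<omega> $ i) = density lborel ?N"
  proof (rule measure_eqI)
    fix S assume "S \<in> sets (distr M lborel (\<lambda>\<omega>. Z \<omega> $ i))"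
    then have [measurable]: "S \<in> sets borel" by simp
    have S: "(\<lambda>z. z $ i) -` S \<in> sets borel"
      using measurable_sets[OF borel_measurable_nth] by (metis \<open>S \<in> sets borel\<close> inf_top_right space_borel)
    have "emeasure (distr M lborel (\<lambda>\<omega>. Z \<omega> $ i)) S = emeasure M (Z -` ((\<lambda>z. z $ i) -` S) \<inter> space M)"
      by (subst emeasure_distr) (auto simp: vimage_def)
    also have "\<dots> = (\<integral>\<^sup>+ z. ennreal (mv_normal_density \<mu> A z) * indicator ((\<lambda>z. z $ i) -` S) z \<partial>lborel)"
      using S by (intro distributed_emeasure[OF Z]) simp
    also have "\<dots> = (\<integral>\<^sup>+ p. ennreal (mv_normal_density \<mu> A (?f p)) * indicator ((\<lambda>z. z $ i) -` S) (?f p)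
        \<partial>(lborel \<Otimes>\<^sub>M lborel))"
      using S by (subst lborel_vec_2[of i], subst nn_integral_distr) simp_all
    also have "\<dots> = (\<integral>\<^sup>+ p. ennreal (?N (fst p) * normal_density (?m (fst p)) ?s (snd p)) * indicator S (fst p)
        \<partial>(lborel \<Otimes>\<^sub>M lborel))"
      by (intro nn_integral_cong)
         (auto simp: mv_normal_density_2[OF A ij] indicator_def)
    also have "\<dots> = (\<integral>\<^sup>+ x. \<integral>\<^sup>+ y. ennreal (?N x * normal_density (?m x) ?s y) * indicator S x \<partial>lborel \<partial>lborel)"
      by (subst lborel.nn_integral_fst[symmetric]) (simp_all add: normal_density_def)
    also have "\<dots> = (\<integral>\<^sup>+ x. \<integral>\<^sup>+ y. (ennreal (?N x) * indicator S x) * ennreal (normal_density (?m x) ?s y) \<partial>lborel \<partial>lborel)"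
      by (intro nn_integral_cong) (simp add: ennreal_mult' mult_ac)
    also have "\<dots> = (\<integral>\<^sup>+ x. ennreal (?N x) * indicator S x \<partial>lborel)"
      by (subst nn_integral_cmult) (auto simp: one)
    finally show "emeasure (distr M lborel (\<lambda>\<omega>. Z \<omega> $ i)) S = emeasure (density lborel ?N) S"
      by (simp add: emeasure_density)
  qed simp
  then show ?thesis by (simp add: distributed_def)
qed

section \<open>Gaussian and log-normal tails\<close>

text \<open>Translating the integral gives
  \<open>\<phi> (t + h) = exp (- t h - h\<^sup>2 / 2) \<phi> t \<le> exp (- x h) \<phi> t\<close> for \<open>t > x\<close>.\<close>
lemma std_normal_tail_shift:
  fixes x h :: real
  assumes "h \<ge> 0"
  shows "measure (density lborel std_normal_density) {x + h<..}
    \<le> exp (- x * h) * measure (density lborel std_normal_density) {x<..}"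
proof -
  interpret N: prob_space "density lborel std_normal_density"
    by (rule prob_space_normal_density) simp
  have tail: "emeasure (density lborel std_normal_density) {a<..}
      = (\<integral>\<^sup>+ t. ennreal (std_normal_density t) * indicator {a<..} t \<partial>lborel)" for a
    by (simp add: emeasure_density)
  have "emeasure (density lborel std_normal_density) {x + h<..}
      = (\<integral>\<^sup>+ t. ennreal (std_normal_density (h + 1 * t)) * indicator {x + h<..} (h + 1 * t) \<partial>lborel)"
    unfolding tail by (subst nn_integral_real_affine[where c = 1 and t = h]) simp_all
  also have "\<dots> \<le> (\<integral>\<^sup>+ t. ennreal (exp (- x * h)) * (ennreal (std_normal_density t) * indicator {x<..} t) \<partial>lborel)"
  proof (intro nn_integral_mono)
    fix t :: real
    have "std_normal_density (h + t) \<le> exp (- x * h) * std_normal_density t" if "t > x"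
    proof -
      have "x * h \<le> t * h" using that assms by (simp add: mult_right_mono)
      then have "- (h + t)\<^sup>2 / 2 \<le> - x * h + - t\<^sup>2 / 2"
        using zero_le_square[of h] by (simp add: power2_eq_square field_simps del: zero_le_square)
      then show ?thesis
        by (auto simp: std_normal_density_def exp_add[symmetric] intro!: divide_right_mono)
    qed
    then show "ennreal (std_normal_density (h + 1 * t)) * indicator {x + h<..} (h + 1 * t)
        \<le> ennreal (exp (- x * h)) * (ennreal (std_normal_density t) * indicator {x<..} t)"
      by (auto simp: indicator_def ennreal_mult'[symmetric])
  qed
  also have "\<dots> = exp (- x * h) * emeasure (density lborel std_normal_density) {x<..}"
    unfolding tail by (subst nn_integral_cmult) simp_all
  finally show ?thesis
    by (simp add: N.emeasure_eq_measure ennreal_mult'[symmetric])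
qed

text \<open>The density is positive everywhere, so a tail of mass zero would be Lebesgue null,
  although it contains an interval of length 1.\<close>

lemma std_normal_tail_pos: "measure (density lborel std_normal_density) {x<..} > 0"
proof -
  interpret N: prob_space "density lborel std_normal_density"
    by (rule prob_space_normal_density) simp
  have "emeasure (density lborel std_normal_density) {x<..} \<noteq> 0"
  proof
    assume "emeasure (density lborel std_normal_density) {x<..} = 0"
    then have "AE t in lborel. t \<notin> {x<..}"
      by (subst (asm) emeasure_density)
         (auto simp: nn_integral_0_iff_AE indicator_def normal_density_def not_le
           elim!: eventually_mono split: if_splits)
    then have "emeasure lborel {x<..} = 0"
      by (subst (asm) AE_iff_null) (auto simp: null_sets_def greaterThan_def)
    moreover have "emeasure lborel {x<..x + 1} \<le> emeasure lborel {x<..}"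
      by (intro emeasure_mono) auto
    ultimately show False by simp
  qed
  then show ?thesis
    by (simp add: N.emeasure_eq_measure zero_less_measure_iff)
qed

text \<open>Taking logarithms and standardising reduces all tail comparisons to one function, the
  standard normal tail.\<close>

lemma lognormal_tail:
  fixes m s k :: real
  assumes "prob_space M" "0 < s" "0 < k"
    and Z: "distributed M lborel Z (normal_density m s)"
  shows "measure M {\<omega> \<in> space M. exp (Z \<omega>) > k}
    = measure (density lborel std_normal_density) {(ln k - m) / s<..}"
proof -
  interpret prob_space M by fact
  have U: "distributed M lborel (\<lambda>\<omega>. (Z \<omega> - m) / s) std_normal_density"
    using Z normal_standard_normal_convert[OF \<open>0 < s\<close>] by simp
  have "exp (Z \<omega>) > k \<longleftrightarrow> (Z \<omega> - m) / s > (ln k - m) / s" for \<omega>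
    using \<open>0 < s\<close> \<open>0 < k\<close> exp_less_cancel_iff[of "ln k" "Z \<omega>"] by (simp add: divide_less_cancel)
  then have "measure M {\<omega> \<in> space M. exp (Z \<omega>) > k}
      = measure (distr M lborel (\<lambda>\<omega>. (Z \<omega> - m) / s)) {(ln k - m) / s<..}"
    using distributed_measurable[OF U]
    by (subst measure_distr) (auto intro!: arg_cong[where f = "measure M"])
  then show ?thesis
    by (simp add: distributed_distr_eq_density[OF U])
qed

text \<open>After standardisation both thresholds on the left exceed the one on the right by at
  least a fixed \<open>h\<close>: the first because of the factor \<open>c\<close>, the second
  because \<open>s1 < s2\<close> makes its distance grow with \<open>ln k\<close>. Each left-hand
  tail is then at most half of the right-hand one. Only the marginal laws enter.\<close>

lemma lognormal_heavier_tail: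
  fixes m1 m2 s1 s2 c C :: real
  assumes M: "prob_space M" and s: "0 < s1" "s1 < s2" and c: "c > 1" and C: "C > 0"
    and Z1: "distributed M lborel Z1 (normal_density m1 s1)"
    and Z2: "distributed M lborel Z2 (normal_density m2 s2)"
  shows "\<forall>\<^sub>F k in at_top. measure M {\<omega> \<in> space M. exp (Z2 \<omega>) > c * k}
      + measure M {\<omega> \<in> space M. exp (Z1 \<omega>) > C * k} \<le> measure M {\<omega> \<in> space M. exp (Z2 \<omega>) > k}"
proof -
  interpret N: prob_space "density lborel std_normal_density"
    by (rule prob_space_normal_density) simp
  let ?T = "\<lambda>x. measure (density lborel std_normal_density) {x<..}"
  have antimono: "?T y \<le> ?T x" if "x \<le> y" for x y
    using that by (intro N.finite_measure_mono) auto
  \<comment> \<open>The factor \<open>c\<close> moves the standardised threshold by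
    \<open>ln c / s2\<close>; the threshold of \<open>Z1\<close> will be at least 1 further out. The
    minimum serves both.\<close>
  define h where "h = min 1 (ln c / s2)"
  have h: "0 < h" "h \<le> 1" "h \<le> ln c / s2"
    using s c by (auto simp: h_def)
  \<comment> \<open>This bound amounts to \<open>x * h \<ge> ln 2\<close> for the \<open>x\<close>
    defined below, which turns the shift factor into at most \<open>1 / 2\<close>.\<close>
  have "\<forall>\<^sub>F k in at_top. ln k \<ge> m2 + s2 * ln 2 / h"
    using ln_at_top by (simp add: filterlim_at_top)
  \<comment> \<open>This is \<open>x + 1 \<le> (ln (C * k) - m1) / s1\<close> solved for
    \<open>ln k\<close>, using \<open>s2 - s1 > 0\<close>.\<close>
  moreover have "\<forall>\<^sub>F k in at_top. ln k \<ge> (s1 * s2 - s1 * m2 - s2 * (ln C - m1)) / (s2 - s1)"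
    using ln_at_top by (simp add: filterlim_at_top)
  ultimately show ?thesis
    using eventually_gt_at_top[of 0]
  proof eventually_elim
    case (elim k)
    define x where "x = (ln k - m2) / s2"
    have "ln 2 \<le> x * h"
      using elim(1) s h by (simp add: x_def field_simps)
    then have "exp (- x * h) \<le> exp (- ln 2)"
      by simp
    then have half: "exp (- x * h) \<le> 1 / 2"
      by (simp add: exp_minus)
    have shift: "?T y \<le> ?T x / 2" if "y \<ge> x + h" for y
    proof -
      have "?T y \<le> exp (- x * h) * ?T x"
        using antimono[OF that] std_normal_tail_shift[of h x] h by simp
      also have "\<dots> \<le> 1 / 2 * ?T x"
        using half by (intro mult_right_mono) auto
      finally show ?thesis by simp
    qed
    have "(ln (c * k) - m2) / s2 = x + ln c / s2"
      using c elim(3) by (simp add: x_def ln_mult add_divide_distrib diff_divide_distrib)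
    then have 2: "?T ((ln (c * k) - m2) / s2) \<le> ?T x / 2"
      using h by (intro shift) simp
    have "s1 * (ln k - m2) + s1 * s2 \<le> s2 * (ln k + ln C - m1)"
      using elim(2) s by (simp add: field_simps)
    then have "x + 1 \<le> (ln (C * k) - m1) / s1"
      using C elim(3) s by (simp add: x_def ln_mult field_simps)
    then have 1: "?T ((ln (C * k) - m1) / s1) \<le> ?T x / 2"
      using h by (intro shift) simp
    show ?case
      using 1 2 s c C elim(3)
      by (simp add: lognormal_tail[OF M _ _ Z1] lognormal_tail[OF M _ _ Z2] x_def)
  qed
qed

section \<open>From tails to quantiles\<close>

lemma quantile_cong:
  assumes "\<And>\<omega>. \<omega> \<in> space M \<Longrightarrow> Y \<omega> = Y' \<omega>"
  shows "quantile M Y \<alpha> = quantile M Y' \<alpha>"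
proof -
  have "{\<omega> \<in> space M. Y \<omega> \<le> y} = {\<omega> \<in> space M. Y' \<omega> \<le> y}" for y
    using assms by auto
  then show ?thesis
    by (simp add: quantile_def)
qed

text \<open>With \<open>F\<close> and \<open>G\<close> the distribution functions of
  \<open>X2\<close> and of the sum, \<open>G y \<le> F (y / t2)\<close> holds for all
  \<open>y\<close> and \<open>F k \<le> G (c * t2 * k)\<close> for large \<open>k\<close>. Passing
  to generalised inverses traps the ratio of quantiles between 1 and \<open>c\<close>.\<close>

lemma quantile_sum_heavier_tail:
  fixes X1 X2 :: "'a \<Rightarrow> real"
  assumes "prob_space M"
    and [measurable]: "X1 \<in> borel_measurable M" "X2 \<in> borel_measurable M"
    and nonneg: "\<And>\<omega>. \<omega> \<in> space M \<Longrightarrow> X1 \<omega> \<ge> 0" "\<And>\<omega>. \<omega> \<in> space M \<Longrightarrow> X2 \<omega> \<ge> 0"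
    and t: "t1 > 0" "t2 > 0"
    and unbounded: "\<And>y. measure M {\<omega> \<in> space M. X2 \<omega> > y} > 0"
    and heavier: "\<And>c C. c > 1 \<Longrightarrow> C > 0 \<Longrightarrow> \<forall>\<^sub>F k in at_top. measure M {\<omega> \<in> space M. X2 \<omega> > c * k}
      + measure M {\<omega> \<in> space M. X1 \<omega> > C * k} \<le> measure M {\<omega> \<in> space M. X2 \<omega> > k}"
  shows "((\<lambda>\<alpha>. quantile M (\<lambda>\<omega>. t1 * X1 \<omega> + t2 * X2 \<omega>) \<alpha> / (quantile M X2 \<alpha> * t2)) \<longlongrightarrow> 1)
    (at_left 1)"
proof (rule tendstoI)
  interpret prob_space M by fact
  let ?S = "\<lambda>\<omega>. t1 * X1 \<omega> + t2 * X2 \<omega>"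
  define F G where "F y = prob {\<omega> \<in> space M. X2 \<omega> \<le> y}" and "G y = prob {\<omega> \<in> space M. ?S \<omega> \<le> y}" for y
  have compl: "prob {\<omega> \<in> space M. Y \<omega> > y} = 1 - prob {\<omega> \<in> space M. Y \<omega> \<le> y}"
    if [measurable]: "Y \<in> borel_measurable M" for Y :: "'a \<Rightarrow> real" and y
    by (subst prob_compl[symmetric]) (auto intro!: arg_cong[where f = prob])
  have mono: "F x \<le> F y" if "x \<le> y" for x y
    unfolding F_def using that by (intro finite_measure_mono) auto
  have F_less_1: "F y < 1" for y
    using unbounded[of y] by (simp add: F_def compl)
  have neg: "F y = 0" "G y = 0" if "y < 0" for y
  proof -
    have "{\<omega> \<in> space M. X2 \<omega> \<le> y} = {}" "{\<omega> \<in> space M. ?S \<omega> \<le> y} = {}"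
      using that nonneg t by (force simp: not_le intro: less_le_trans add_nonneg_nonneg)+
    then show "F y = 0" "G y = 0" by (simp_all only: F_def G_def measure_empty)
  qed
  \<comment> \<open>A real \<open>Inf\<close> obeys its usual bounds only for nonempty sets bounded
    below; nonnegativity supplies the lower bound 0 once \<open>\<alpha> > 0\<close>.\<close>
  have bdd: "bdd_below {y. \<alpha> \<le> F y}" "bdd_below {y. \<alpha> \<le> G y}" if "\<alpha> > 0" for \<alpha>
  proof -
    have "y \<ge> 0" if "\<alpha> \<le> F y \<or> \<alpha> \<le> G y" for y
      using neg[of y] that \<open>\<alpha> > 0\<close> by force
    then show "bdd_below {y. \<alpha> \<le> F y}" "bdd_below {y. \<alpha> \<le> G y}"
      by (auto intro!: bdd_belowI[of _ 0])
  qed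
  have lim: "(F \<longlongrightarrow> 1) at_top"
  proof -
    interpret D: real_distribution "distr M borel X2"
      by (intro real_distribution_distr) simp
    have "cdf (distr M borel X2) = F"
      by (auto simp: fun_eq_iff cdf_def F_def measure_distr intro!: arg_cong[where f = prob])
    then show ?thesis using D.cdf_lim_at_top_prob by simp
  qed
  fix e :: real
  assume e: "e > 0"
  define c where "c = 1 + e / 2"
  have c: "c > 1" using e by (simp add: c_def)
  \<comment> \<open>The excess \<open>(c - 1) * t2 * k\<close> is shared equally: \<open>X2\<close>
    may reach \<open>(1 + c) / 2 * k\<close>, and \<open>t1 * (C * k)\<close> is the other
    half.\<close>
  define C where "C = t2 * (c - 1) / (2 * t1)"
  have C: "C > 0" using t c by (simp add: C_def)
  obtain K0 where K0: "\<And>k. k \<ge> K0 \<Longrightarrow> prob {\<omega> \<in> space M. X2 \<omega> > (1 + c) / 2 * k}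
      + prob {\<omega> \<in> space M. X1 \<omega> > C * k} \<le> prob {\<omega> \<in> space M. X2 \<omega> > k}"
    using heavier[of "(1 + c) / 2" C] c C by (auto simp: eventually_at_top_linorder)
  \<comment> \<open>The lower bound 1 makes the quantile of \<open>X2\<close> positive, so that
    dividing by it is safe.\<close>
  define K where "K = max 1 K0"
  have GF: "F k \<le> G (c * t2 * k)" if "k \<ge> K" for k
  proof -
    have "?S \<omega> \<le> c * t2 * k" if "X2 \<omega> \<le> (1 + c) / 2 * k" "X1 \<omega> \<le> C * k" for \<omega>
    proof -
      have "?S \<omega> \<le> t1 * (C * k) + t2 * ((1 + c) / 2 * k)"
        using that t by (intro add_mono mult_left_mono) auto
      also have "\<dots> = c * t2 * k"
        using t by (simp add: C_def field_simps)
      finally show ?thesis .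
    qed
    then have "{\<omega> \<in> space M. ?S \<omega> > c * t2 * k}
        \<subseteq> {\<omega> \<in> space M. X2 \<omega> > (1 + c) / 2 * k} \<union> {\<omega> \<in> space M. X1 \<omega> > C * k}"
      by (auto simp: not_le[symmetric])
    then have "prob {\<omega> \<in> space M. ?S \<omega> > c * t2 * k}
        \<le> prob ({\<omega> \<in> space M. X2 \<omega> > (1 + c) / 2 * k} \<union> {\<omega> \<in> space M. X1 \<omega> > C * k})"
      by (intro finite_measure_mono) auto
    also have "\<dots> \<le> prob {\<omega> \<in> space M. X2 \<omega> > (1 + c) / 2 * k} + prob {\<omega> \<in> space M. X1 \<omega> > C * k}"
      by (intro measure_Un_le) auto
    also have "\<dots> \<le> prob {\<omega> \<in> space M. X2 \<omega> > k}"
      using that by (intro K0) (simp add: K_def)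
    finally show ?thesis
      by (simp add: compl F_def G_def)
  qed
  \<comment> \<open>A level above \<open>F K\<close> forces the quantile of \<open>X2\<close> to be
    at least \<open>K\<close>; such levels exist below 1 because \<open>X2\<close> is
    unbounded.\<close>
  have "\<forall>\<^sub>F \<alpha> in at_left 1. \<alpha> \<in> {max 0 (F K)<..<1}"
    using F_less_1[of K] by (intro eventually_at_leftI[of "max 0 (F K)"]) auto
  then show "\<forall>\<^sub>F \<alpha> in at_left 1. dist (quantile M ?S \<alpha> / (quantile M X2 \<alpha> * t2)) 1 < e"
  proof eventually_elim
    case (elim \<alpha>)
    then have \<alpha>: "0 < \<alpha>" "\<alpha> < 1" "F K < \<alpha>" by auto
    define k q where "k = quantile M X2 \<alpha>" and "q = quantile M ?S \<alpha>"
    have k: "k = Inf {y. \<alpha> \<le> F y}" and q: "q = Inf {y. \<alpha> \<le> G y}"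
      by (simp_all add: k_def q_def quantile_def F_def G_def)
    have "\<forall>\<^sub>F y in at_top. F y > \<alpha>"
      using lim \<alpha> by (simp add: order_tendsto_iff)
    then obtain y0 where "F y0 > \<alpha>"
      by (auto simp: eventually_at_top_linorder)
    then have ne: "{y. \<alpha> \<le> F y} \<noteq> {}"
      by (auto intro: less_imp_le)
    have kK: "k \<ge> K"
      unfolding k
    proof (rule cInf_greatest[OF ne])
      fix y assume "y \<in> {y. \<alpha> \<le> F y}"
      then show "K \<le> y" using mono[of y K] \<alpha> by force
    qed
    then have k0: "k > 0" by (simp add: K_def)
    \<comment> \<open>The infimum \<open>k\<close> is approached from above: each
      \<open>k' > k\<close> lies beyond some \<open>y\<close> with
      \<open>\<alpha> \<le> F y\<close>, and \<open>dense_ge\<close> lets \<open>k'\<close> decrease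
      to \<open>k\<close> afterwards.\<close>
    have G: "\<alpha> \<le> G (c * t2 * k')" if "k' > k" for k'
    proof -
      obtain y where "\<alpha> \<le> F y" "y < k'"
        using cInf_lessD[OF ne, of k'] \<open>k' > k\<close> k by auto
      then have "\<alpha> \<le> F k'" using mono[of y k'] by simp
      also have "\<dots> \<le> G (c * t2 * k')" using that kK by (intro GF) simp
      finally show ?thesis .
    qed
    have "q / (c * t2) \<le> k"
    proof (rule dense_ge)
      fix k' assume "k < k'"
      then have "q \<le> c * t2 * k'"
        unfolding q using bdd(2)[OF \<open>0 < \<alpha>\<close>] G by (intro cInf_lower) auto
      then show "q / (c * t2) \<le> k'" using c t by (simp add: field_simps)
    qed
    then have upper: "q \<le> c * (k * t2)" using c t by (simp add: field_simps)
    have lower: "k * t2 \<le> q"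
      unfolding q
    proof (rule cInf_greatest)
      show "{y. \<alpha> \<le> G y} \<noteq> {}" using G[of "k + 1"] by auto
    next
      fix y assume "y \<in> {y. \<alpha> \<le> G y}"
      \<comment> \<open>Since \<open>t1 * X1\<close> is nonnegative, a sum of at most
        \<open>y\<close> forces \<open>X2\<close> to be at most \<open>y / t2\<close>.\<close>
      moreover have "G y \<le> F (y / t2)"
        unfolding F_def G_def using t nonneg(1)
        by (intro finite_measure_mono) (auto simp: field_simps intro: order_trans[rotated])
      ultimately have "k \<le> y / t2"
        unfolding k using bdd(1)[OF \<open>0 < \<alpha>\<close>] by (intro cInf_lower) auto
      then show "k * t2 \<le> y" using t by (simp add: field_simps)
    qed
    have "1 \<le> q / (k * t2)" "q / (k * t2) \<le> c"
      using upper lower k0 t by (simp_all add: divide_simps)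
    then show ?case
      using e by (simp add: k_def q_def dist_real_def c_def)
  qed
qed

section \<open>Variance ordering and the limit for the log-normal pair\<close>

theorem mainTheorem6:
  fixes M :: "'a measure"
    and Z X :: "'a \<Rightarrow> real ^ 2"
    and \<mu> b :: "real ^ 2"
    and A B :: "real ^ 2 ^ 2"
    and t1 :: real
  assumes "prob_space M"
    and "pos_def_matrix A"
    and "distributed M lborel Z (\<lambda>z. ennreal (mv_normal_density \<mu> A z))"
    and "\<And>\<omega> i. \<omega> \<in> space M \<Longrightarrow> X \<omega> $ i = exp (Z \<omega> $ i)"
    and "B = matrix_inv A"
    and "\<And>i. b $ i = B $ 1 $ i + B $ 2 $ i"
    and "b $ 1 > b $ 2"
    and "b $ 2 > 0 \<Longrightarrow> (b $ 1)\<^sup>2 / B $ 1 $ 1 > (b $ 2)\<^sup>2 / B $ 2 $ 2"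
    and "0 < t1" "t1 < 1"
  shows "((\<lambda>\<alpha>. portfolio_quantile M X \<alpha> t1 (1 - t1)
              / (portfolio_quantile M X \<alpha> 0 1 * (1 - t1))) \<longlongrightarrow> 1) (at_left 1)"
proof -
  note M = assms(1) and A = assms(2)
  let ?X = "\<lambda>i \<omega>. exp (Z \<omega> $ i)"
  \<comment> \<open>By symmetry of \<open>A\<close> both column sums contain the same term
    \<open>- A $ 1 $ 2 / det A\<close>, so the covariance cancels.\<close>
  have "b $ 1 - b $ 2 = (A $ 2 $ 2 - A $ 1 $ 1) / det A"
    using pos_def_matrix_2[OF A] unfolding assms(5,6) by (simp add: matrix_inv_2 field_simps)
  then have "0 < (A $ 2 $ 2 - A $ 1 $ 1) / det A"
    using assms(7) by simp
  then have var: "A $ 1 $ 1 < A $ 2 $ 2"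
    using pos_def_matrix_2(3)[OF A] by (simp add: zero_less_divide_iff)
  note marginal = mv_normal_marginal[OF A assms(3)]
  have sd: "0 < sqrt (A $ i $ i)" for i
    using pos_def_matrix_2(2)[OF A] by simp
  have meas: "?X i \<in> borel_measurable M" for i
    using distributed_measurable[OF marginal[of i]] by simp
  have "measure M {\<omega> \<in> space M. ?X 2 \<omega> > y} > 0" for y
  proof -
    interpret prob_space M by (rule M)
    \<comment> \<open>The logarithmic tail formula requires a positive threshold, hence
      \<open>max 1 y\<close>; raising the threshold only shrinks the event.\<close>
    have "0 < measure M {\<omega> \<in> space M. ?X 2 \<omega> > max 1 y}"
      by (subst lognormal_tail[OF M sd _ marginal]) (simp_all add: std_normal_tail_pos)
    also have "\<dots> \<le> measure M {\<omega> \<in> space M. ?X 2 \<omega> > y}"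
      using meas[of 2] by (intro finite_measure_mono) auto
    finally show ?thesis .
  qed
  then have lim: "((\<lambda>\<alpha>. quantile M (\<lambda>\<omega>. t1 * ?X 1 \<omega> + (1 - t1) * ?X 2 \<omega>) \<alpha>
      / (quantile M (?X 2) \<alpha> * (1 - t1))) \<longlongrightarrow> 1) (at_left 1)"
    using assms(9,10) meas var
    by (intro quantile_sum_heavier_tail M lognormal_heavier_tail[OF M sd _ _ _ marginal marginal]) auto
  \<comment> \<open>The exponential form of \<open>X\<close> is given only on
    \<open>space M\<close>, and quantiles see no other points.\<close>
  have "portfolio_quantile M X \<alpha> u1 u2 = quantile M (\<lambda>\<omega>. u1 * ?X 1 \<omega> + u2 * ?X 2 \<omega>) \<alpha>" for \<alpha> u1 u2
    unfolding portfolio_quantile_def by (intro quantile_cong) (simp add: assms(4))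
  with lim show ?thesis by simp
qed

end
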